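(* Let $K$ be an algebraically closed field, $n\ge2$, and let $A=(A_1,\dots,A_n)$ be an $n$-tuple of $3\times4$-matrices of rank $3$ over $K$. If $A$ is generic, then $M_n=\mathrm{in}_\prec(J_A)$, where $$M_n=\bigl\langle x_ix_j,\ x_iy_jy_k,\ y_iy_jy_ky_l\ :\ i,j,k,l\in\{1,\dots,n\}\ \text{distinct}\bigr\rangle\subset K[x,y,z]$$ and $\prec$ is the lexicographic term order with $x_1\succ\cdots\succ x_n\succ y_1\succ\cdots\succ y_n\succ z_1\succ\cdots\succ z_n$.
   Context: $K[x,y,z]$ is the polynomial ring in the $3n$ unknowns $x_i,y_i,z_i$ ($1\le i\le n$), where $(x_i:y_i:z_i)$ are coordinates on the $i$-th factor of $(\mathbb{P}^2)^n$. The multiview ideal $J_A\subset K[x,y,z]$ is the prime ideal of all polynomials vanishing on the closure $V_A\subset(\mathbb{P}^2)^n$ of the image of the rational map $\mathbb{P}^3\dashrightarrow(\mathbb{P}^2)^n$, $\mathbf{x}\mapsto(A_1\mathbf{x},\dots,A_n\mathbf{x})$. $A$ is generic if all $4\times4$-minors of the $4\times3n$-matrix $[A_1^T\ A_2^T\ \cdots\ A_n^T]$ are non-zero. In the definition of $M_n$, the generators $x_ix_j$ run over distinct pairs, $x_iy_jy_k$ over distinct triples, and $y_iy_jy_ky_l$ over distinct quadruples of indices. $\mathrm{in}_\prec(J_A)$ denotes the initial monomial ideal of $J_A$ with respect to $\prec$. *)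

theory Defs
  imports "HOL-Analysis.Analysis" "HOL-Library.Poly_Mapping"
    "HOL-Computational_Algebra.Polynomial"
begin

section \<open>The polynomial ring\<close>

text \<open>The type variable 'n is the index set of the n cameras: a finite linearly ordered type
  stands for the set of numbers from 1 to n.\<close>

datatype 'n var = X 'n | Y 'n | Z 'n

text \<open>The order on the variables is the order in which they are listed,
  x_1, ..., x_n, y_1, ..., y_n, z_1, ..., z_n, so a smaller element of the type is a larger
  variable in the term order.\<close>

fun var_block :: "'n var \<Rightarrow> nat" where
  "var_block (X i) = 0"
| "var_block (Y i) = 1"
| "var_block (Z i) = 2"

fun var_index :: "'n var \<Rightarrow> 'n" where
  "var_index (X i) = i"
| "var_index (Y i) = i"
| "var_index (Z i) = i"

instantiation var :: (linorder) linorder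
begin

definition less_var :: "'a var \<Rightarrow> 'a var \<Rightarrow> bool" where
  "v < w \<longleftrightarrow> var_block v < var_block w \<or> (var_block v = var_block w \<and> var_index v < var_index w)"

definition less_eq_var :: "'a var \<Rightarrow> 'a var \<Rightarrow> bool" where
  "v \<le> w \<longleftrightarrow> v < w \<or> v = w" for v w :: "'a var"

instance
proof
  fix u v w :: "'a var"
  show "(v < w) = (v \<le> w \<and> \<not> w \<le> v)" "v \<le> v"
    by (auto simp: less_var_def less_eq_var_def)
  show "u \<le> v \<Longrightarrow> v \<le> w \<Longrightarrow> u \<le> w" "v \<le> w \<Longrightarrow> w \<le> v \<Longrightarrow> v = w"
    by (auto simp: less_var_def less_eq_var_def)
  show "v \<le> w \<or> w \<le> v"
    by (cases v; cases w; auto simp: less_var_def less_eq_var_def)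
qed

end

type_synonym 'n monom = "'n var \<Rightarrow>\<^sub>0 nat"
type_synonym ('n, 'k) mpoly = "'n monom \<Rightarrow>\<^sub>0 'k"

definition mon :: "'n monom \<Rightarrow> ('n, 'k::comm_ring_1) mpoly" where
  "mon m = Poly_Mapping.single m 1"

definition var :: "'n var \<Rightarrow> ('n, 'k::comm_ring_1) mpoly" where
  "var v = mon (Poly_Mapping.single v 1)"

definition poly_eval :: "('n var \<Rightarrow> 'k) \<Rightarrow> ('n, 'k::comm_ring_1) mpoly \<Rightarrow> 'k" where
  "poly_eval a p = (\<Sum>m\<in>Poly_Mapping.keys p. Poly_Mapping.lookup p m *
     (\<Prod>v\<in>Poly_Mapping.keys m. a v ^ Poly_Mapping.lookup m v))"

text \<open>The ideal generated by a set is the span in the ring as a module over itself.\<close>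

abbreviation ideal_gen :: "'a::comm_ring_1 set \<Rightarrow> 'a set" where
  "ideal_gen \<equiv> module.span (*)"

section \<open>Initial ideals for the lexicographic order\<close>

text \<open>The library order on finitely supported functions is lexicographic, the smallest key at
  which two functions differ being decisive. On monomials it is therefore the lexicographic term
  order in which x_1 is the largest variable; the following lemma spells this out.\<close>

lemma less_monom_iff:
  fixes s t :: "'n::linorder monom"
  shows "s < t \<longleftrightarrow> (\<exists>v. Poly_Mapping.lookup s v < Poly_Mapping.lookup t v \<and>
    (\<forall>w<v. Poly_Mapping.lookup s w = Poly_Mapping.lookup t w))"
  by (simp add: less_poly_mapping.rep_eq less_fun_def)

definition initial_monomial :: "('n::linorder, 'k::comm_ring_1) mpoly \<Rightarrow> 'n monom" where
  "initial_monomial p = Max (Poly_Mapping.keys p)"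

definition initial_ideal ::
    "('n::linorder, 'k::comm_ring_1) mpoly set \<Rightarrow> ('n, 'k) mpoly set" where
  "initial_ideal J = ideal_gen {mon (initial_monomial p) | p. p \<in> J \<and> p \<noteq> 0}"

section \<open>Projective space and products of projective planes\<close>

definition proj_rel :: "(('k::field^'m) \<times> ('k^'m)) set" where
  "proj_rel = {(v, w). v \<noteq> 0 \<and> w \<noteq> 0 \<and> (\<exists>c. w = c *s v)}"

text \<open>A point of projective space is the set of all its homogeneous coordinate vectors.\<close>

definition proj_space :: "('k::field^'m) set set" where
  "proj_space = {v. v \<noteq> 0} // proj_rel"

definition plane_product :: "('n \<Rightarrow> ('k::field^3) set) set" where
  "plane_product = {P. \<forall>i. P i \<in> proj_space}"

fun coords :: "('n \<Rightarrow> 'k^3) \<Rightarrow> 'n var \<Rightarrow> 'k" where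
  "coords u (X i) = u i $ 1"
| "coords u (Y i) = u i $ 2"
| "coords u (Z i) = u i $ 3"

text \<open>A polynomial, multihomogeneous or not, vanishes at a point if it vanishes for every choice
  of homogeneous coordinates of the point.\<close>

definition vanishes_at :: "('n, 'k::field) mpoly \<Rightarrow> ('n \<Rightarrow> ('k^3) set) \<Rightarrow> bool" where
  "vanishes_at p P \<longleftrightarrow> (\<forall>u. (\<forall>i. u i \<in> P i) \<longrightarrow> poly_eval (coords u) p = 0)"

definition multihomogeneous :: "('n, 'k::comm_ring_1) mpoly \<Rightarrow> bool" where
  "multihomogeneous p \<longleftrightarrow> (\<exists>d. \<forall>m\<in>Poly_Mapping.keys p. \<forall>i.
     Poly_Mapping.lookup m (X i) + Poly_Mapping.lookup m (Y i) + Poly_Mapping.lookup m (Z i) = d i)"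

definition zariski_closed :: "('n \<Rightarrow> ('k::field^3) set) set \<Rightarrow> bool" where
  "zariski_closed C \<longleftrightarrow> (\<exists>S. (\<forall>p\<in>S. multihomogeneous p) \<and>
     C = {P \<in> plane_product. \<forall>p\<in>S. vanishes_at p P})"

definition zariski_closure ::
    "('n \<Rightarrow> ('k::field^3) set) set \<Rightarrow> ('n \<Rightarrow> ('k^3) set) set" where
  "zariski_closure D = \<Inter>{C. zariski_closed C \<and> D \<subseteq> C}"

section \<open>Multiview varieties\<close>

definition multiview_image ::
    "('n \<Rightarrow> 'k::field^4^3) \<Rightarrow> ('n \<Rightarrow> ('k^3) set) set" where
  "multiview_image A = {\<lambda>i. proj_rel `` {A i *v x} | Q x.
     Q \<in> proj_space \<and> x \<in> Q \<and> (\<forall>i. A i *v x \<noteq> 0)}"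

definition multiview_variety ::
    "('n \<Rightarrow> 'k::field^4^3) \<Rightarrow> ('n \<Rightarrow> ('k^3) set) set" where
  "multiview_variety A = zariski_closure (multiview_image A)"

definition multiview_ideal :: "('n \<Rightarrow> 'k::field^4^3) \<Rightarrow> ('n, 'k) mpoly set" where
  "multiview_ideal A = {p. \<forall>P\<in>multiview_variety A. vanishes_at p P}"

text \<open>The matrix with blocks A_1^T, ..., A_n^T; its columns are indexed by pairs consisting of a
  camera and a row of that camera.\<close>

definition joint_matrix :: "('n::finite \<Rightarrow> 'k::field^4^3) \<Rightarrow> 'k^('n \<times> 3)^4" where
  "joint_matrix A = (\<chi> r c. transpose (A (fst c)) $ r $ snd c)"

text \<open>A choice of four distinct columns is an injective map; listing the same columns in another
  order only changes the sign of the minor.\<close>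

definition generic_cameras :: "('n::finite \<Rightarrow> 'k::field^4^3) \<Rightarrow> bool" where
  "generic_cameras A \<longleftrightarrow> (\<forall>f :: 4 \<Rightarrow> 'n \<times> 3. inj f \<longrightarrow>
     det (\<chi> r c. joint_matrix A $ r $ f c) \<noteq> 0)"

definition M_ideal :: "('n, 'k::comm_ring_1) mpoly set" where
  "M_ideal = ideal_gen
     ({var (X i) * var (X j) | i j. i \<noteq> j} \<union>
      {var (X i) * var (Y j) * var (Y k) | i j k. distinct [i, j, k]} \<union>
      {var (Y i) * var (Y j) * var (Y k) * var (Y l) | i j k l. distinct [i, j, k, l]})"

end

theory Submission
  imports Defs
begin

text \<open>The generators of the monomial ideal are initial monomials of the bilinear, trilinear and
  quadrilinear forms that come from the maximal minors of the incidence matrices of the cameras;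
  their leading coefficients are minors of the joint matrix. Such a form is built from the
  determinant of four rows by contracting, for each camera, two rows with (z, -y, x) or one row with
  (z, -y).

  Conversely, a monomial m that no generator divides is not initial for a polynomial of the
  multiview ideal. There are weights on the variables, positive on exactly three of them, for which
  m is lighter than every lexicographically smaller monomial of the same multidegree. As any four
  rows are independent, a curve x(t) in space exists along which each image coordinate vanishes at
  t = 0 exactly to the order of its weight, and the term of m alone determines the lowest order
  coefficient of the polynomial along this curve.\<close>

section \<open>Evaluation of monomials and polynomials\<close>

definition monom_eval :: "('n var \<Rightarrow> 'k::comm_ring_1) \<Rightarrow> 'n monom \<Rightarrow> 'k" where
  "monom_eval a m = (\<Prod>v\<in>Poly_Mapping.keys m. a v ^ Poly_Mapping.lookup m v)"

text \<open>Any finite superset of the support may serve as index set, so that two polynomials can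
  be evaluated over a common one.\<close>

lemma poly_eval_eq_sum:
  assumes "finite S" "Poly_Mapping.keys p \<subseteq> S"
  shows "poly_eval a p = (\<Sum>m\<in>S. Poly_Mapping.lookup p m * monom_eval a m)"
  unfolding poly_eval_def monom_eval_def
  by (rule sum.mono_neutral_left) (use assms in \<open>auto simp: in_keys_iff\<close>)

lemma monom_eval_eq_prod:
  assumes "finite S" "Poly_Mapping.keys m \<subseteq> S"
  shows "monom_eval a m = (\<Prod>v\<in>S. a v ^ Poly_Mapping.lookup m v)"
  unfolding monom_eval_def
  by (rule prod.mono_neutral_left) (use assms in \<open>auto simp: in_keys_iff\<close>)

lemma monom_eval_add: "monom_eval a (m + m') = monom_eval a m * monom_eval a m'"
proof -
  let ?S = "Poly_Mapping.keys m \<union> Poly_Mapping.keys m'"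
  have "Poly_Mapping.keys (m + m') \<subseteq> ?S" by (rule Poly_Mapping.keys_add)
  then show ?thesis
    by (simp add: monom_eval_eq_prod[of ?S] lookup_add power_add prod.distrib)
qed

lemma monom_eval_single: "monom_eval a (Poly_Mapping.single v k) = a v ^ k"
  by (subst monom_eval_eq_prod[of "{v}"]) auto

lemma poly_eval_add: "poly_eval a (p + q) = poly_eval a p + poly_eval a q"
proof -
  let ?S = "Poly_Mapping.keys p \<union> Poly_Mapping.keys q"
  have "Poly_Mapping.keys (p + q) \<subseteq> ?S" by (rule Poly_Mapping.keys_add)
  then show ?thesis
    by (simp add: poly_eval_eq_sum[of ?S] lookup_add sum.distrib distrib_right)
qed

lemma poly_eval_single: "poly_eval a (Poly_Mapping.single m c) = c * monom_eval a m"
  by (subst poly_eval_eq_sum[of "{m}"]) auto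

lemma poly_eval_diff: "poly_eval a (p - q) = poly_eval a p - poly_eval a q"
  using poly_eval_add[of a "p - q" q] by simp

lemma poly_eval_sum: "poly_eval a (sum f S) = (\<Sum>s\<in>S. poly_eval a (f s))"
proof (induction S rule: infinite_finite_induct)
  case empty
  then show ?case by (simp add: poly_eval_def)
qed (simp_all add: poly_eval_add, simp add: poly_eval_def)

lemma poly_mapping_eq_sum_single:
  "p = (\<Sum>m\<in>Poly_Mapping.keys p. Poly_Mapping.single m (Poly_Mapping.lookup p m))"
  by (rule poly_mapping_eqI) (auto simp: lookup_sum lookup_single when_def in_keys_iff)

lemma single_mult_eq_sum:
  fixes p :: "('n, 'k::comm_ring_1) mpoly"
  shows "Poly_Mapping.single k 1 * p =
    (\<Sum>m\<in>Poly_Mapping.keys p. Poly_Mapping.single (k + m) (Poly_Mapping.lookup p m))"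
  by (subst (1) poly_mapping_eq_sum_single[of p]) (simp add: sum_distrib_left mult_single)

lemma lookup_single_mult:
  fixes p :: "('n, 'k::comm_ring_1) mpoly"
  shows "Poly_Mapping.lookup (Poly_Mapping.single k 1 * p) (k + m) = Poly_Mapping.lookup p m"
  by (auto simp: single_mult_eq_sum lookup_sum lookup_single when_def in_keys_iff)

lemma lookup_single_mult_nonzero:
  fixes p :: "('n, 'k::comm_ring_1) mpoly"
  assumes "Poly_Mapping.lookup (Poly_Mapping.single k 1 * p) m \<noteq> 0"
  obtains m' where "m = k + m'" "Poly_Mapping.lookup p m' \<noteq> 0"
proof -
  from assms obtain m' where "m' \<in> Poly_Mapping.keys p"
    "Poly_Mapping.lookup (Poly_Mapping.single (k + m') (Poly_Mapping.lookup p m')) m \<noteq> 0"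
    unfolding single_mult_eq_sum lookup_sum by (meson sum.not_neutral_contains_not_neutral)
  then show ?thesis
    using that[of m'] by (auto simp: lookup_single when_def in_keys_iff split: if_splits)
qed

lemma poly_eval_var_mult: "poly_eval a (var v * p) = a v * poly_eval a p"
proof -
  have "poly_eval a (var v * p) =
      (\<Sum>m\<in>Poly_Mapping.keys p. a v * (Poly_Mapping.lookup p m * monom_eval a m))"
    unfolding var_def mon_def single_mult_eq_sum poly_eval_sum poly_eval_single monom_eval_add
      monom_eval_single by (simp add: mult_ac)
  also have "\<dots> = a v * poly_eval a p"
    by (simp add: poly_eval_def monom_eval_def sum_distrib_left)
  finally show ?thesis .
qed

section \<open>Multidegrees with respect to the cameras\<close>

definition mdeg :: "'n monom \<Rightarrow> 'n \<Rightarrow> nat" where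
  "mdeg m i = Poly_Mapping.lookup m (X i) + Poly_Mapping.lookup m (Y i) + Poly_Mapping.lookup m (Z i)"

lemma mdeg_add: "mdeg (m + m') i = mdeg m i + mdeg m' i"
  by (simp add: mdeg_def lookup_add)

lemma mdeg_single: "mdeg (Poly_Mapping.single v k) i = (if var_index v = i then k else 0)"
  by (cases v) (auto simp: mdeg_def lookup_single when_def)

text \<open>Having \<open>d\<close> as a parameter, unlike in \<open>multihomogeneous\<close>, makes
  the property stable under sums and differences; the zero polynomial has every multidegree.\<close>

definition multidegree_is :: "('n, 'k::comm_ring_1) mpoly \<Rightarrow> ('n \<Rightarrow> nat) \<Rightarrow> bool" where
  "multidegree_is p d \<longleftrightarrow> (\<forall>m. Poly_Mapping.lookup p m \<noteq> 0 \<longrightarrow> mdeg m = d)"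

lemma multidegree_is_add:
  "multidegree_is p d \<Longrightarrow> multidegree_is q d \<Longrightarrow> multidegree_is (p + q) d"
  by (auto simp: multidegree_is_def lookup_add) (metis add.right_neutral)

lemma multidegree_is_diff:
  "multidegree_is p d \<Longrightarrow> multidegree_is q d \<Longrightarrow> multidegree_is (p - q) d"
  by (auto simp: multidegree_is_def lookup_minus) (metis diff_zero)

lemma multidegree_is_var_mult:
  assumes "multidegree_is p d"
  shows "multidegree_is (var v * p) (\<lambda>i. (if var_index v = i then 1 else 0) + d i)"
  unfolding multidegree_is_def var_def mon_def
proof (intro allI impI)
  fix m assume "Poly_Mapping.lookup (Poly_Mapping.single (Poly_Mapping.single v 1) 1 * p) m \<noteq> 0"
  then show "mdeg m = (\<lambda>i. (if var_index v = i then 1 else 0) + d i)"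
    by (rule lookup_single_mult_nonzero)
      (use assms in \<open>auto simp: multidegree_is_def mdeg_add mdeg_single fun_eq_iff\<close>)
qed

lemma multihomogeneous_if_multidegree_is: "multidegree_is p d \<Longrightarrow> multihomogeneous p"
  by (auto simp: multidegree_is_def multihomogeneous_def mdeg_def in_keys_iff fun_eq_iff
      intro!: exI[of _ d])

section \<open>Leading terms for the lexicographic order\<close>

text \<open>The coefficient \<open>c\<close> may be zero: \<open>m\<close> is only an upper bound
  for the monomials of \<open>p\<close>. Leading terms therefore add without case distinctions, even
  when they cancel.\<close>

definition leading :: "'n::linorder monom \<Rightarrow> 'k::comm_ring_1 \<Rightarrow> ('n, 'k) mpoly \<Rightarrow> bool" where
  "leading m c p \<longleftrightarrow>
    (\<forall>k. Poly_Mapping.lookup p k \<noteq> 0 \<longrightarrow> k \<le> m) \<and> Poly_Mapping.lookup p m = c"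

lemma leading_add: "leading m c p \<Longrightarrow> leading m c' q \<Longrightarrow> leading m (c + c') (p + q)"
  by (auto simp: leading_def lookup_add) (metis add.right_neutral)

lemma leading_diff: "leading m c p \<Longrightarrow> leading m c' q \<Longrightarrow> leading m (c - c') (p - q)"
  by (auto simp: leading_def lookup_minus) (metis diff_zero)

lemma leading_var_mult:
  assumes "leading m c p"
  shows "leading (Poly_Mapping.single v 1 + m) c (var v * p)"
  unfolding leading_def var_def mon_def
proof (intro conjI allI impI)
  fix k assume "Poly_Mapping.lookup (Poly_Mapping.single (Poly_Mapping.single v 1) 1 * p) k \<noteq> 0"
  then show "k \<le> Poly_Mapping.single v 1 + m"
    by (rule lookup_single_mult_nonzero)
      (use assms in \<open>auto simp: leading_def intro: add_left_mono\<close>)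
qed (use assms in \<open>simp add: lookup_single_mult leading_def\<close>)

lemma single_less_single:
  fixes v w :: "'n::linorder var"
  assumes "v < w"
  shows "Poly_Mapping.single w (1::nat) < Poly_Mapping.single v 1"
  unfolding less_monom_iff
  by (rule exI[of _ v]) (use assms in \<open>auto simp: lookup_single when_def\<close>)

text \<open>The order on variables is reversed on monomials: for \<open>v < w\<close> every monomial
  of \<open>var w * p\<close> lies strictly below the bound. Such products do not influence the
  leading coefficient of a contraction.\<close>

lemma leading_var_mult_smaller:
  assumes "leading m c p" and "v < w"
  shows "leading (Poly_Mapping.single v 1 + m) 0 (var w * p)"
proof -
  have less: "Poly_Mapping.single w 1 + m < Poly_Mapping.single v 1 + m"
    using single_less_single[OF assms(2)] by (rule add_strict_right_mono)
  have "leading (Poly_Mapping.single w 1 + m) c (var w * p)"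
    using assms(1) by (rule leading_var_mult)
  then show ?thesis
    using less unfolding leading_def by (meson order.strict_trans1 leD order.strict_implies_order)
qed

lemma initial_monomial_leading:
  assumes "leading m c p" "c \<noteq> 0"
  shows "initial_monomial p = m" "p \<noteq> 0"
proof -
  show "initial_monomial p = m" unfolding initial_monomial_def
    by (rule Max_eqI) (use assms in \<open>auto simp: leading_def in_keys_iff\<close>)
  show "p \<noteq> 0" using assms by (auto simp: leading_def)
qed

section \<open>Camera rows and their four-by-four determinants\<close>

fun camera_row :: "('n \<Rightarrow> 'k^4^3) \<Rightarrow> 'n var \<Rightarrow> 'k^4" where
  "camera_row A (X i) = A i $ 1"
| "camera_row A (Y i) = A i $ 2"
| "camera_row A (Z i) = A i $ 3"

definition dot :: "'k::field^'m \<Rightarrow> 'k^'m \<Rightarrow> 'k" where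
  "dot p x = (\<Sum>j\<in>UNIV. p $ j * x $ j)"

lemma dot_diff: "dot (p - q) x = dot p x - dot q x"
  and dot_scale: "dot (c *s p) x = c * dot p x"
  by (simp_all add: dot_def algebra_simps sum.distrib sum_subtractf sum_distrib_left)

lemma dot_add_right: "dot p (x + y) = dot p x + dot p y"
  and dot_scale_right: "dot p (c *s x) = c * dot p x"
  by (simp_all add: dot_def algebra_simps sum.distrib sum_subtractf sum_distrib_left)

lemma coords_camera: "coords (\<lambda>l. A l *v x) v = dot (camera_row A v) x"
  by (cases v) (simp_all add: dot_def matrix_vector_mult_def)

definition det4 :: "'k::field^4 \<Rightarrow> 'k^4 \<Rightarrow> 'k^4 \<Rightarrow> 'k^4 \<Rightarrow> 'k" where
  "det4 p q r s = det (\<chi> i::4. if i = 1 then p else if i = 2 then q else if i = 3 then r else s)"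

lemma det4_add:
  "det4 (p + p') q r s = det4 p q r s + det4 p' q r s"
  "det4 p (q + q') r s = det4 p q r s + det4 p q' r s"
  "det4 p q (r + r') s = det4 p q r s + det4 p q r' s"
  "det4 p q r (s + s') = det4 p q r s + det4 p q r s'"
proof -
  show "det4 (p + p') q r s = det4 p q r s + det4 p' q r s"
    unfolding det4_def
    using det_row_add[of 1 "\<lambda>_. p" "\<lambda>_. p'" "\<lambda>i::4. if i = 2 then q else if i = 3 then r else s"] by simp
  \<comment> \<open>\<open>det_row_add\<close> expects the varying row in the first branch of the
    case distinction, so the branches are permuted.\<close>
  have "(\<chi> i::4. if i = 1 then p else if i = 2 then t else if i = 3 then r else s) =
    (\<chi> i. if i = 2 then t else if i = 1 then p else if i = 3 then r else s)" for t
    by (auto simp: vec_eq_iff)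
  then show "det4 p (q + q') r s = det4 p q r s + det4 p q' r s"
    unfolding det4_def
    using det_row_add[of 2 "\<lambda>_. q" "\<lambda>_. q'" "\<lambda>i::4. if i = 1 then p else if i = 3 then r else s"] by simp
  have "(\<chi> i::4. if i = 1 then p else if i = 2 then q else if i = 3 then t else s) =
    (\<chi> i. if i = 3 then t else if i = 1 then p else if i = 2 then q else s)" for t
    by (auto simp: vec_eq_iff)
  then show "det4 p q (r + r') s = det4 p q r s + det4 p q r' s"
    unfolding det4_def
    using det_row_add[of 3 "\<lambda>_. r" "\<lambda>_. r'" "\<lambda>i::4. if i = 1 then p else if i = 2 then q else s"] by simp
  have "(\<chi> i::4. if i = 1 then p else if i = 2 then q else if i = 3 then r else t) =
    (\<chi> i. if i = 4 then t else if i = 1 then p else if i = 2 then q else r)" for t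
    using exhaust_4 by (auto simp: vec_eq_iff)
  then show "det4 p q r (s + s') = det4 p q r s + det4 p q r s'"
    unfolding det4_def
    using det_row_add[of 4 "\<lambda>_. s" "\<lambda>_. s'" "\<lambda>i::4. if i = 1 then p else if i = 2 then q else r"] by simp
qed

lemma det4_scale:
  "det4 (c *s p) q r s = c * det4 p q r s"
  "det4 p (c *s q) r s = c * det4 p q r s"
  "det4 p q (c *s r) s = c * det4 p q r s"
  "det4 p q r (c *s s) = c * det4 p q r s"
proof -
  show "det4 (c *s p) q r s = c * det4 p q r s"
    unfolding det4_def
    using det_row_mul[of 1 c "\<lambda>_. p" "\<lambda>i::4. if i = 2 then q else if i = 3 then r else s"] by simp
  have "(\<chi> i::4. if i = 1 then p else if i = 2 then t else if i = 3 then r else s) =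
    (\<chi> i. if i = 2 then t else if i = 1 then p else if i = 3 then r else s)" for t
    by (auto simp: vec_eq_iff)
  then show "det4 p (c *s q) r s = c * det4 p q r s"
    unfolding det4_def
    using det_row_mul[of 2 c "\<lambda>_. q" "\<lambda>i::4. if i = 1 then p else if i = 3 then r else s"] by simp
  have "(\<chi> i::4. if i = 1 then p else if i = 2 then q else if i = 3 then t else s) =
    (\<chi> i. if i = 3 then t else if i = 1 then p else if i = 2 then q else s)" for t
    by (auto simp: vec_eq_iff)
  then show "det4 p q (c *s r) s = c * det4 p q r s"
    unfolding det4_def
    using det_row_mul[of 3 c "\<lambda>_. r" "\<lambda>i::4. if i = 1 then p else if i = 2 then q else s"] by simp
  have "(\<chi> i::4. if i = 1 then p else if i = 2 then q else if i = 3 then r else t) =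
    (\<chi> i. if i = 4 then t else if i = 1 then p else if i = 2 then q else r)" for t
    using exhaust_4 by (auto simp: vec_eq_iff)
  then show "det4 p q r (c *s s) = c * det4 p q r s"
    unfolding det4_def
    using det_row_mul[of 4 c "\<lambda>_. s" "\<lambda>i::4. if i = 1 then p else if i = 2 then q else r"] by simp
qed

lemma det4_same: "det4 p p r s = 0" "det4 p q r r = 0"
proof -
  show "det4 p p r s = 0" unfolding det4_def
    by (rule det_identical_rows[of 1 2]) (auto simp: row_def vec_eq_iff)
  show "det4 p q r r = 0" unfolding det4_def
    by (rule det_identical_rows[of 3 4]) (auto simp: row_def vec_eq_iff)
qed

text \<open>The matrix with these rows has the nonzero vector \<open>x\<close> in its
  kernel.\<close>

lemma det4_eq_0_if_orthogonal:
  assumes "x \<noteq> 0" "dot p x = 0" "dot q x = 0" "dot r x = 0" "dot s x = 0"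
  shows "det4 p q r s = 0"
proof -
  let ?M = "\<chi> i::4. if i = 1 then p else if i = 2 then q else if i = 3 then r else s"
  have "?M *v x = 0"
    using assms by (auto simp: vec_eq_iff matrix_vector_mult_def dot_def)
  with \<open>x \<noteq> 0\<close> have "\<not> invertible ?M"
    using invertible_def matrix_left_invertible_ker by blast
  then show ?thesis
    by (simp add: det4_def invertible_det_nz)
qed

text \<open>Distinct variables name distinct columns of the joint matrix, and those columns are the
  camera rows; a transpose turns the minor into \<open>det4\<close>.\<close>

lemma det4_camera_rows_nonzero:
  fixes A :: "'n::finite \<Rightarrow> 'k::field^4^3"
  assumes "generic_cameras A" "distinct [v1, v2, v3, v4]"
  shows "det4 (camera_row A v1) (camera_row A v2) (camera_row A v3) (camera_row A v4) \<noteq> 0"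
proof -
  define col :: "'n var \<Rightarrow> 'n \<times> 3" where
    "col v = (case v of X i \<Rightarrow> (i, 1) | Y i \<Rightarrow> (i, 2) | Z i \<Rightarrow> (i, 3))" for v :: "'n var"
  have inj_col: "col v = col w \<longleftrightarrow> v = w" for v w
    by (cases v; cases w) (simp_all add: col_def)
  have jm: "joint_matrix A $ r $ col v = camera_row A v $ r" for r v
    by (cases v) (simp_all add: joint_matrix_def col_def transpose_def)
  define f :: "4 \<Rightarrow> 'n \<times> 3" where
    "f c = col (if c = 1 then v1 else if c = 2 then v2 else if c = 3 then v3 else v4)" for c
  have "inj f"
    unfolding inj_def f_def inj_col using assms(2) exhaust_4 by (auto split: if_splits)
  with assms(1) have "det (\<chi> r c. joint_matrix A $ r $ f c) \<noteq> 0"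
    by (simp add: generic_cameras_def)
  moreover have "(\<chi> r c. joint_matrix A $ r $ f c) =
      transpose (\<chi> i::4. if i = 1 then camera_row A v1 else if i = 2 then camera_row A v2
        else if i = 3 then camera_row A v3 else camera_row A v4)"
    by (simp add: vec_eq_iff transpose_def f_def jm)
  ultimately show ?thesis
    by (simp add: det4_def)
qed

section \<open>Contraction of alternating forms with one camera\<close>

text \<open>Up to sign, this is a Laplace expansion along a column of image coordinates of camera
  \<open>i\<close>: each coordinate multiplies the form at the other two rows. The values of
  \<open>D\<close> are polynomials so that contractions with several cameras can be nested.\<close>

definition camera_wedge2 ::
    "('n \<Rightarrow> 'k::field^4^3) \<Rightarrow> 'n \<Rightarrow> ('k^4 \<Rightarrow> 'k^4 \<Rightarrow> ('n, 'k) mpoly) \<Rightarrow> ('n, 'k) mpoly" where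
  "camera_wedge2 A i D =
     var (Z i) * D (camera_row A (X i)) (camera_row A (Y i))
     - var (Y i) * D (camera_row A (X i)) (camera_row A (Z i))
     + var (X i) * D (camera_row A (Y i)) (camera_row A (Z i))"

text \<open>The same expansion with the row of \<open>X i\<close> struck out, so that
  \<open>Y i\<close> becomes the largest variable introduced.\<close>

definition camera_wedge1 ::
    "('n \<Rightarrow> 'k::field^4^3) \<Rightarrow> 'n \<Rightarrow> ('k^4 \<Rightarrow> ('n, 'k) mpoly) \<Rightarrow> ('n, 'k) mpoly" where
  "camera_wedge1 A i D =
     var (Z i) * D (camera_row A (Y i)) - var (Y i) * D (camera_row A (Z i))"

text \<open>Among the three variables of the camera \<open>X i\<close> is the largest in the term
  order, so only the summand with the rows of \<open>Y i\<close> and \<open>Z i\<close> reaches the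
  bound.\<close>

lemma leading_camera_wedge2:
  fixes A :: "'n::linorder \<Rightarrow> 'k::field^4^3"
  assumes "\<And>p q. leading m (c p q) (D p q)"
  shows "leading (Poly_Mapping.single (X i) 1 + m)
    (c (camera_row A (Y i)) (camera_row A (Z i))) (camera_wedge2 A i D)"
proof -
  let ?m = "Poly_Mapping.single (X i) 1 + m"
  have "leading ?m 0 (var (Z i) * D (camera_row A (X i)) (camera_row A (Y i)))"
    "leading ?m 0 (var (Y i) * D (camera_row A (X i)) (camera_row A (Z i)))"
    "leading ?m (c (camera_row A (Y i)) (camera_row A (Z i)))
      (var (X i) * D (camera_row A (Y i)) (camera_row A (Z i)))"
    by (rule leading_var_mult_smaller[OF assms] leading_var_mult[OF assms], simp add: less_var_def)+
      (rule leading_var_mult[OF assms])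
  from leading_add[OF leading_diff[OF this(1,2)] this(3)] show ?thesis
    by (simp add: camera_wedge2_def)
qed

lemma leading_camera_wedge1:
  fixes A :: "'n::linorder \<Rightarrow> 'k::field^4^3"
  assumes "\<And>p. leading m (c p) (D p)"
  shows "leading (Poly_Mapping.single (Y i) 1 + m) (- c (camera_row A (Z i))) (camera_wedge1 A i D)"
proof -
  let ?m = "Poly_Mapping.single (Y i) 1 + m"
  have "leading ?m 0 (var (Z i) * D (camera_row A (Y i)))"
    by (rule leading_var_mult_smaller[OF assms]) (simp add: less_var_def)
  moreover have "leading ?m (c (camera_row A (Z i))) (var (Y i) * D (camera_row A (Z i)))"
    by (rule leading_var_mult[OF assms])
  ultimately have "leading ?m (0 - c (camera_row A (Z i))) (camera_wedge1 A i D)"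
    unfolding camera_wedge1_def by (rule leading_diff)
  then show ?thesis by simp
qed

lemma multidegree_is_camera_wedge2:
  assumes "\<And>p q. multidegree_is (D p q) d"
  shows "multidegree_is (camera_wedge2 A i D) (\<lambda>l. (if i = l then 1 else 0) + d l)"
proof -
  have "multidegree_is (var v * D p q) (\<lambda>l. (if i = l then 1 else 0) + d l)"
    if "var_index v = i" for v p q
    using multidegree_is_var_mult[OF assms, of v] that by simp
  then show ?thesis unfolding camera_wedge2_def
    by (intro multidegree_is_add multidegree_is_diff) auto
qed

lemma multidegree_is_camera_wedge1:
  assumes "\<And>p. multidegree_is (D p) d"
  shows "multidegree_is (camera_wedge1 A i D) (\<lambda>l. (if i = l then 1 else 0) + d l)"
proof -
  have "multidegree_is (var v * D p) (\<lambda>l. (if i = l then 1 else 0) + d l)"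
    if "var_index v = i" for v p
    using multidegree_is_var_mult[OF assms, of v] that by simp
  then show ?thesis unfolding camera_wedge1_def
    by (intro multidegree_is_diff) auto
qed

text \<open>Linearity is asked of the values at a fixed point: there the image coordinates are
  scalars and can be moved into the arguments of the form.\<close>

definition linear_form :: "('k::field^4 \<Rightarrow> 'k) \<Rightarrow> bool" where
  "linear_form f \<longleftrightarrow> (\<forall>p q. f (p + q) = f p + f q) \<and> (\<forall>c p. f (c *s p) = c * f p)"

lemma linear_formD:
  assumes "linear_form f"
  shows "f (p + q) = f p + f q" "f (c *s p) = c * f p" "f (p - q) = f p - f q"
proof -
  show *: "f (p + q) = f p + f q" for p q using assms by (simp add: linear_form_def)
  show "f (c *s p) = c * f p" using assms by (simp add: linear_form_def)
  show "f (p - q) = f p - f q" using *[of "p - q" q] by simp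
qed

lemma linear_form_add: "linear_form f \<Longrightarrow> linear_form g \<Longrightarrow> linear_form (\<lambda>p. f p + g p)"
  and linear_form_diff: "linear_form f \<Longrightarrow> linear_form g \<Longrightarrow> linear_form (\<lambda>p. f p - g p)"
  and linear_form_mult: "linear_form f \<Longrightarrow> linear_form (\<lambda>p. c * f p)"
  by (simp_all add: linear_form_def algebra_simps)

lemma linear_form_det4:
  "linear_form (\<lambda>p. det4 p q r s)" "linear_form (\<lambda>q. det4 p q r s)"
  "linear_form (\<lambda>r. det4 p q r s)" "linear_form (\<lambda>s. det4 p q r s)"
  by (simp_all add: linear_form_def det4_add det4_scale)

text \<open>The coefficients of the contraction do not involve \<open>r\<close>, so linearity in an
  outer slot survives an inner contraction.\<close>

lemma linear_form_poly_eval_camera_wedge2: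
  assumes "\<And>p q. linear_form (\<lambda>r. poly_eval a (D r p q))"
  shows "linear_form (\<lambda>r. poly_eval a (camera_wedge2 A i (D r)))"
  unfolding camera_wedge2_def poly_eval_add poly_eval_diff poly_eval_var_mult
  by (intro linear_form_add linear_form_diff linear_form_mult assms)

lemma linear_form_poly_eval_camera_wedge1:
  assumes "\<And>p. linear_form (\<lambda>r. poly_eval a (D r p))"
  shows "linear_form (\<lambda>r. poly_eval a (camera_wedge1 A i (D r)))"
  unfolding camera_wedge1_def poly_eval_diff poly_eval_var_mult
  by (intro linear_form_diff linear_form_mult assms)

text \<open>Carries the vanishing of the determinant at equal outer arguments through an inner
  contraction.\<close>

lemma poly_eval_camera_wedge2_same:
  assumes "\<And>p q. poly_eval a (D p q) = 0"
  shows "poly_eval a (camera_wedge2 A i D) = 0"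
  by (simp add: camera_wedge2_def poly_eval_add poly_eval_diff poly_eval_var_mult assms)

lemma poly_eval_camera_wedge1_same:
  assumes "\<And>p. poly_eval a (D p) = 0"
  shows "poly_eval a (camera_wedge1 A i D) = 0"
  by (simp add: camera_wedge1_def poly_eval_diff poly_eval_var_mult assms)

text \<open>By linearity the contraction is the value of the form at one vector, and that vector is
  orthogonal to \<open>x\<close>. The factors \<open>c\<close> stand for the free choice of
  homogeneous coordinates in each camera.\<close>

lemma poly_eval_camera_wedge1_eq_0:
  fixes A :: "'n \<Rightarrow> 'k::field^4^3"
  assumes lin: "linear_form (\<lambda>p. poly_eval a (D p))"
    and vanish: "\<And>p. dot p x = 0 \<Longrightarrow> poly_eval a (D p) = 0"
    and a: "\<And>v. a v = c (var_index v) * dot (camera_row A v) x"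
  shows "poly_eval a (camera_wedge1 A i D) = 0"
proof -
  let ?p = "a (Z i) *s camera_row A (Y i) - a (Y i) *s camera_row A (Z i)"
  have "poly_eval a (camera_wedge1 A i D) = poly_eval a (D ?p)"
    by (simp add: camera_wedge1_def poly_eval_diff poly_eval_var_mult linear_formD[OF lin])
  also have "\<dots> = 0"
    by (rule vanish) (simp add: a dot_diff dot_scale del: camera_row.simps)
  finally show ?thesis .
qed

text \<open>For u proportional to the image of x, the vectors u_k a_l - u_l a_k built from the rows a of
  the camera are orthogonal to x, and each coordinate of u times the contraction is a value of the
  given alternating form at such vectors.\<close>

lemma poly_eval_camera_wedge2_eq_0:
  fixes A :: "'n \<Rightarrow> 'k::field^4^3"
  assumes lin1: "\<And>q. linear_form (\<lambda>p. poly_eval a (D p q))"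
    and lin2: "\<And>p. linear_form (\<lambda>q. poly_eval a (D p q))"
    and same: "\<And>p. poly_eval a (D p p) = 0"
    and vanish: "\<And>p q. dot p x = 0 \<Longrightarrow> dot q x = 0 \<Longrightarrow> poly_eval a (D p q) = 0"
    and a: "\<And>v. a v = c (var_index v) * dot (camera_row A v) x"
  shows "poly_eval a (camera_wedge2 A i D) = 0"
proof -
  define E where "E p q = poly_eval a (D p q)" for p q
  define W where "W = poly_eval a (camera_wedge2 A i D)"
  define r1 r2 r3 where "r1 = camera_row A (X i)" and "r2 = camera_row A (Y i)"
    and "r3 = camera_row A (Z i)"
  define u1 u2 u3 where "u1 = a (X i)" and "u2 = a (Y i)" and "u3 = a (Z i)"
  note linE = linear_formD[OF lin1, folded E_def] linear_formD[OF lin2, folded E_def]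
  have same: "E p p = 0" for p by (simp add: E_def same)
  \<comment> \<open>Polarisation of \<open>same\<close>; nothing is divided by two, so the
    characteristic is arbitrary.\<close>
  have swap: "E q p = - E p q" for p q
  proof -
    have "E (p + q) (p + q) = E p p + E q p + (E p q + E q q)"
      by (simp only: linE)
    then have "E q p + E p q = 0"
      unfolding same by simp
    then show ?thesis
      by (simp add: eq_neg_iff_add_eq_0)
  qed
  have W: "W = u3 * E r1 r2 - u2 * E r1 r3 + u1 * E r2 r3"
    by (simp add: W_def camera_wedge2_def poly_eval_add poly_eval_diff poly_eval_var_mult E_def
        u1_def u2_def u3_def r1_def r2_def r3_def)
  have u: "u1 = c i * dot r1 x" "u2 = c i * dot r2 x" "u3 = c i * dot r3 x"
    unfolding u1_def u2_def u3_def r1_def r2_def r3_def a by simp_all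
  have "u3 * W = E (u3 *s r1 - u1 *s r3) (u3 *s r2 - u2 *s r3)"
    unfolding W by (simp add: linE same swap[of r2 r3] algebra_simps)
  also have "\<dots> = 0" unfolding E_def by (rule vanish) (simp_all add: dot_diff dot_scale u)
  finally have 3: "u3 * W = 0" .
  have "u2 * W = E (u2 *s r1 - u1 *s r2) (u3 *s r2 - u2 *s r3)"
    unfolding W by (simp add: linE same algebra_simps)
  also have "\<dots> = 0" unfolding E_def by (rule vanish) (simp_all add: dot_diff dot_scale u)
  finally have 2: "u2 * W = 0" .
  have "u1 * W = E (u1 *s r2 - u2 *s r1) (u1 *s r3 - u3 *s r1)"
    unfolding W by (simp add: linE same swap[of r1 r2] algebra_simps)
  also have "\<dots> = 0" unfolding E_def by (rule vanish) (simp_all add: dot_diff dot_scale u)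
  finally have "u1 * W = 0" .
  \<comment> \<open>A nonzero coordinate can be cancelled; if all three coordinates vanish, so does
    \<open>W\<close> by its formula.\<close>
  with 2 3 show ?thesis unfolding W_def[symmetric] by (auto simp: W)
qed

section \<open>The bilinear, trilinear and quadrilinear forms in the multiview ideal\<close>

text \<open>The zero set of a multihomogeneous polynomial is closed; once it contains the image, it
  contains the closure.\<close>

lemma multiview_ideal_if_vanishes_on_image:
  assumes hom: "multihomogeneous p"
    and vanish: "\<And>c x. x \<noteq> 0 \<Longrightarrow>
      poly_eval (\<lambda>v. c (var_index v) * dot (camera_row A v) x) p = 0"
  shows "p \<in> multiview_ideal A"
proof -
  let ?C = "{P \<in> plane_product. \<forall>q\<in>{p}. vanishes_at q P}"
  have "zariski_closed ?C"
    unfolding zariski_closed_def using hom by blast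
  moreover have "multiview_image A \<subseteq> ?C"
  proof
    fix P assume "P \<in> multiview_image A"
    then obtain Q x where P: "P = (\<lambda>i. proj_rel `` {A i *v x})" and "Q \<in> proj_space" "x \<in> Q"
      and nz: "\<And>i. A i *v x \<noteq> 0"
      unfolding multiview_image_def by blast
    then have "x \<noteq> 0"
      by (auto simp: proj_space_def proj_rel_def quotient_def)
    have "vanishes_at p P"
      unfolding vanishes_at_def
    proof (intro allI impI)
      fix u assume "\<forall>i. u i \<in> P i"
      then have "\<forall>i. \<exists>c. u i = c *s (A i *v x)"
        by (auto simp: P proj_rel_def)
      then obtain c where u: "\<And>i. u i = c i *s (A i *v x)" by metis
      have "coords u v = c (var_index v) * dot (camera_row A v) x" for v
        unfolding coords_camera[symmetric] by (cases v) (simp_all add: u)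
      then have "coords u = (\<lambda>v. c (var_index v) * dot (camera_row A v) x)" by blast
      then show "poly_eval (coords u) p = 0" using vanish[OF \<open>x \<noteq> 0\<close>] by simp
    qed
    moreover have "P \<in> plane_product"
      using nz by (auto simp: P plane_product_def proj_space_def quotient_def)
    ultimately show "P \<in> ?C" by simp
  qed
  ultimately have "multiview_variety A \<subseteq> ?C"
    unfolding multiview_variety_def zariski_closure_def by blast
  then show ?thesis
    by (auto simp: multiview_ideal_def)
qed

lemma leading_const: "leading 0 c (Poly_Mapping.single 0 c)"
  by (auto simp: leading_def lookup_single when_def)

lemma multidegree_is_const: "multidegree_is (Poly_Mapping.single 0 c) (\<lambda>_. 0)"
  by (auto simp: multidegree_is_def lookup_single when_def mdeg_def)

lemma poly_eval_const: "poly_eval a (Poly_Mapping.single 0 c) = c"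
  by (simp add: poly_eval_single monom_eval_def)

text \<open>The four slots of the determinant are split 2+2 between the cameras. Taking out
  \<open>X i\<close> and \<open>X j\<close> leaves the \<open>Y\<close> and \<open>Z\<close> rows of
  both, and their minor is nonzero by genericity.\<close>

lemma initial_monomial_bilinear:
  fixes A :: "'n::{finite,linorder} \<Rightarrow> 'k::field^4^3"
  assumes "generic_cameras A" "i \<noteq> j"
  obtains p where "p \<in> multiview_ideal A" "p \<noteq> 0"
    "initial_monomial p = Poly_Mapping.single (X i) 1 + Poly_Mapping.single (X j) 1"
proof -
  define D where "D p q r s = Poly_Mapping.single (0 :: 'n monom) (det4 p q r s)" for p q r s :: "'k^4"
  define P where "P = camera_wedge2 A i (\<lambda>p q. camera_wedge2 A j (D p q))"
  have D: "poly_eval a (D p q r s) = det4 p q r s" for a p q r s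
    by (simp add: D_def poly_eval_const)
  have "leading (Poly_Mapping.single (X i) 1 + (Poly_Mapping.single (X j) 1 + 0))
    (det4 (camera_row A (Y i)) (camera_row A (Z i)) (camera_row A (Y j)) (camera_row A (Z j))) P"
    unfolding P_def D_def
    by (rule leading_camera_wedge2, rule leading_camera_wedge2, rule leading_const)
  moreover have "det4 (camera_row A (Y i)) (camera_row A (Z i)) (camera_row A (Y j)) (camera_row A (Z j)) \<noteq> 0"
    by (rule det4_camera_rows_nonzero) (use assms in auto)
  moreover have "P \<in> multiview_ideal A"
  proof (rule multiview_ideal_if_vanishes_on_image)
    show "multihomogeneous P" unfolding P_def D_def
      by (rule multihomogeneous_if_multidegree_is, rule multidegree_is_camera_wedge2,
          rule multidegree_is_camera_wedge2, rule multidegree_is_const)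
    fix c and x :: "'k^4" assume "x \<noteq> 0"
    \<comment> \<open>Each contraction vanishes as soon as its form vanishes at slots orthogonal to
      \<open>x\<close>. Peeling off both contractions leaves a determinant of four rows orthogonal
      to \<open>x\<close>.\<close>
    then show "poly_eval (\<lambda>v. c (var_index v) * dot (camera_row A v) x) P = 0"
      unfolding P_def
      by (intro poly_eval_camera_wedge2_eq_0[of _ _ x c] linear_form_poly_eval_camera_wedge2
          poly_eval_camera_wedge2_same)
        (auto simp: D linear_form_det4 det4_same intro: det4_eq_0_if_orthogonal)
  qed
  ultimately show ?thesis
    using that initial_monomial_leading by (metis add.right_neutral)
qed

text \<open>Here the slots are split 2+1+1; the signs of the two single contractions cancel.\<close>

lemma initial_monomial_trilinear:
  fixes A :: "'n::{finite,linorder} \<Rightarrow> 'k::field^4^3"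
  assumes "generic_cameras A" "distinct [i, j, k]"
  obtains p where "p \<in> multiview_ideal A" "p \<noteq> 0"
    "initial_monomial p =
      Poly_Mapping.single (X i) 1 + (Poly_Mapping.single (Y j) 1 + Poly_Mapping.single (Y k) 1)"
proof -
  define D where "D p q r s = Poly_Mapping.single (0 :: 'n monom) (det4 p q r s)" for p q r s :: "'k^4"
  define P where "P = camera_wedge2 A i (\<lambda>p q. camera_wedge1 A j (\<lambda>r. camera_wedge1 A k (D p q r)))"
  have D: "poly_eval a (D p q r s) = det4 p q r s" for a p q r s
    by (simp add: D_def poly_eval_const)
  have "leading (Poly_Mapping.single (X i) 1 + (Poly_Mapping.single (Y j) 1 + (Poly_Mapping.single (Y k) 1 + 0)))
    (- (- det4 (camera_row A (Y i)) (camera_row A (Z i)) (camera_row A (Z j)) (camera_row A (Z k)))) P"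
    unfolding P_def D_def
    by (rule leading_camera_wedge2, rule leading_camera_wedge1, rule leading_camera_wedge1,
        rule leading_const)
  moreover have "det4 (camera_row A (Y i)) (camera_row A (Z i)) (camera_row A (Z j)) (camera_row A (Z k)) \<noteq> 0"
    by (rule det4_camera_rows_nonzero) (use assms in auto)
  moreover have "P \<in> multiview_ideal A"
  proof (rule multiview_ideal_if_vanishes_on_image)
    show "multihomogeneous P" unfolding P_def D_def
      by (rule multihomogeneous_if_multidegree_is, rule multidegree_is_camera_wedge2,
          rule multidegree_is_camera_wedge1, rule multidegree_is_camera_wedge1,
          rule multidegree_is_const)
    fix c and x :: "'k^4" assume "x \<noteq> 0"
    then show "poly_eval (\<lambda>v. c (var_index v) * dot (camera_row A v) x) P = 0"
      unfolding P_def
      by (intro poly_eval_camera_wedge2_eq_0[of _ _ x c] poly_eval_camera_wedge1_eq_0[of _ _ x c]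
          linear_form_poly_eval_camera_wedge1 poly_eval_camera_wedge1_same)
        (auto simp: D linear_form_det4 det4_same intro: det4_eq_0_if_orthogonal)
  qed
  ultimately show ?thesis
    using that initial_monomial_leading by (metis add.right_neutral add.inverse_inverse)
qed

text \<open>Here each of four cameras fills one slot, and the leading coefficient is the minor of
  the four \<open>Z\<close> rows.\<close>

lemma initial_monomial_quadrilinear:
  fixes A :: "'n::{finite,linorder} \<Rightarrow> 'k::field^4^3"
  assumes "generic_cameras A" "distinct [i, j, k, l]"
  obtains p where "p \<in> multiview_ideal A" "p \<noteq> 0"
    "initial_monomial p = Poly_Mapping.single (Y i) 1 + (Poly_Mapping.single (Y j) 1 +
      (Poly_Mapping.single (Y k) 1 + Poly_Mapping.single (Y l) 1))"
proof -
  define D where "D p q r s = Poly_Mapping.single (0 :: 'n monom) (det4 p q r s)" for p q r s :: "'k^4"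
  define P where "P = camera_wedge1 A i (\<lambda>p. camera_wedge1 A j
    (\<lambda>q. camera_wedge1 A k (\<lambda>r. camera_wedge1 A l (D p q r))))"
  have D: "poly_eval a (D p q r s) = det4 p q r s" for a p q r s
    by (simp add: D_def poly_eval_const)
  have "leading (Poly_Mapping.single (Y i) 1 + (Poly_Mapping.single (Y j) 1 +
      (Poly_Mapping.single (Y k) 1 + (Poly_Mapping.single (Y l) 1 + 0))))
    (- (- (- (- det4 (camera_row A (Z i)) (camera_row A (Z j)) (camera_row A (Z k)) (camera_row A (Z l)))))) P"
    unfolding P_def D_def
    by (rule leading_camera_wedge1, rule leading_camera_wedge1, rule leading_camera_wedge1,
        rule leading_camera_wedge1, rule leading_const)
  moreover have "det4 (camera_row A (Z i)) (camera_row A (Z j)) (camera_row A (Z k)) (camera_row A (Z l)) \<noteq> 0"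
    by (rule det4_camera_rows_nonzero) (use assms in auto)
  moreover have "P \<in> multiview_ideal A"
  proof (rule multiview_ideal_if_vanishes_on_image)
    show "multihomogeneous P" unfolding P_def D_def
      by (rule multihomogeneous_if_multidegree_is, (rule multidegree_is_camera_wedge1)+,
          rule multidegree_is_const)
    fix c and x :: "'k^4" assume "x \<noteq> 0"
    then show "poly_eval (\<lambda>v. c (var_index v) * dot (camera_row A v) x) P = 0"
      unfolding P_def
      by (intro poly_eval_camera_wedge1_eq_0[of _ _ x c] linear_form_poly_eval_camera_wedge1)
        (auto simp: D linear_form_det4 intro: det4_eq_0_if_orthogonal)
  qed
  ultimately show ?thesis
    using that initial_monomial_leading by (metis add.right_neutral add.inverse_inverse)
qed

section \<open>Vanishing of the multihomogeneous parts\<close>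

text \<open>Over a finite field, one plus the product of all linear factors
  \<open>[:- a, 1:]\<close> has no root.\<close>

lemma infinite_alg_closed_field: "infinite (UNIV :: 'k::alg_closed_field set)"
proof
  assume fin: "finite (UNIV :: 'k set)"
  define q :: "'k poly" where "q = (\<Prod>a\<in>UNIV. [:- a, 1:])"
  have deg: "degree q = card (UNIV :: 'k set)"
    unfolding q_def by (subst degree_prod_eq_sum_degree) auto
  have "card (UNIV :: 'k set) > 0"
    using fin by (simp add: card_gt_0_iff)
  then have "degree (q + 1) > 0"
    using deg by (subst degree_add_eq_left) auto
  then obtain x where "poly (q + 1) x = 0"
    by (rule alg_closed_imp_poly_has_root[THEN exE])
  moreover have "poly q x = 0"
    unfolding q_def poly_prod using fin by (intro prod_zero) auto
  ultimately show False by simp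
qed

lemma poly_eq_0_if_infinite_roots:
  fixes p :: "'k::idom poly"
  assumes "infinite {t. poly p t = 0}"
  shows "p = 0"
  using assms poly_roots_finite by blast

text \<open>Comparison of coefficients, one coordinate at a time: the set \<open>L\<close> holds the
  coordinates whose exponents have already been fixed to those of \<open>d\<close>.\<close>

lemma multigraded_separation:
  fixes b :: "'m \<Rightarrow> 'k::idom" and e :: "'m \<Rightarrow> 'n::finite \<Rightarrow> nat"
  assumes inf: "infinite (UNIV :: 'k set)" and fin: "finite S"
    and zero: "\<And>c. (\<forall>i. c i \<noteq> 0) \<Longrightarrow> (\<Sum>m\<in>S. b m * (\<Prod>i\<in>UNIV. c i ^ e m i)) = 0"
  shows "(\<Sum>m | m \<in> S \<and> e m = d. b m) = 0"
proof -
  have "(\<Sum>m | m \<in> S \<and> (\<forall>i\<in>L. e m i = d i). b m * (\<Prod>i\<in>-L. c i ^ e m i)) = 0"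
    if "finite L" "\<forall>i. c i \<noteq> 0" for L c
    using that
  proof (induction L arbitrary: c rule: finite_induct)
    case empty
    then show ?case using zero[of c] by simp
  next
    case (insert l L)
    let ?S = "{m \<in> S. \<forall>i\<in>L. e m i = d i}"
    define f where "f m = b m * (\<Prod>i\<in>-insert l L. c i ^ e m i)" for m
    \<comment> \<open>The sum as a polynomial in coordinate \<open>l\<close> alone, the other
      coordinates being frozen; its coefficient at \<open>d l\<close> is the sum wanted for
      \<open>insert l L\<close>.\<close>
    define P where "P = (\<Sum>m\<in>?S. monom (f m) (e m l))"
    have compl: "- L = insert l (- insert l L)" using insert.hyps by auto
    have "poly P t = 0" if "t \<noteq> 0" for t
    proof -
      have "(\<Sum>m\<in>?S. b m * (\<Prod>i\<in>-L. (c(l := t)) i ^ e m i)) = 0"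
        by (rule insert.IH) (use insert.prems that in auto)
      also have "(\<Sum>m\<in>?S. b m * (\<Prod>i\<in>-L. (c(l := t)) i ^ e m i)) = (\<Sum>m\<in>?S. f m * t ^ e m l)"
      proof (rule sum.cong[OF refl])
        fix m
        have "(\<Prod>i\<in>-insert l L. (c(l := t)) i ^ e m i) = (\<Prod>i\<in>-insert l L. c i ^ e m i)"
          by (rule prod.cong) auto
        then show "b m * (\<Prod>i\<in>-L. (c(l := t)) i ^ e m i) = f m * t ^ e m l"
          unfolding compl f_def by (subst prod.insert) (auto simp: mult_ac)
      qed
      finally show ?thesis by (simp add: P_def poly_sum poly_monom)
    qed
    then have "UNIV - {0} \<subseteq> {t. poly P t = 0}" by auto
    then have "P = 0"
      using inf by (intro poly_eq_0_if_infinite_roots) (meson finite_Diff2 finite.intros infinite_super)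
    then have "coeff P (d l) = 0" by simp
    then have "(\<Sum>m\<in>?S. f m when e m l = d l) = 0"
      by (simp add: P_def coeff_sum when_def)
    moreover have "(\<Sum>m\<in>?S. f m when e m l = d l) = (\<Sum>m | m \<in> ?S \<and> e m l = d l. f m)"
      unfolding when_def using fin by (subst sum.inter_filter) auto
    moreover have "{m. m \<in> ?S \<and> e m l = d l} = {m \<in> S. \<forall>i\<in>insert l L. e m i = d i}" by auto
    ultimately show ?case by (simp add: f_def)
  qed
  from this[of UNIV "\<lambda>_. 1"] show ?thesis by (simp add: fun_eq_iff)
qed

text \<open>The three blocks give finiteness of the type and let products over all variables be
  regrouped by camera.\<close>

lemma UNIV_var: "(UNIV :: 'n var set) = range X \<union> range Y \<union> range Z"
proof -
  have "v \<in> range X \<union> range Y \<union> range Z" for v :: "'n var" by (cases v) auto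
  then show ?thesis by blast
qed

instance var :: (finite) finite
  by standard (simp add: UNIV_var)

lemma monom_eval_scaled_coords:
  fixes m :: "'n::finite monom"
  shows "monom_eval (\<lambda>v. c (var_index v) * a v) m = (\<Prod>i\<in>UNIV. c i ^ mdeg m i) * monom_eval a m"
proof -
  have inj: "inj_on X UNIV" "inj_on Y UNIV" "inj_on Z UNIV" by (auto simp: inj_on_def)
  have "(\<Prod>v\<in>UNIV. c (var_index v) ^ Poly_Mapping.lookup m v) =
      (\<Prod>v\<in>range X. c (var_index v) ^ Poly_Mapping.lookup m v) *
      (\<Prod>v\<in>range Y. c (var_index v) ^ Poly_Mapping.lookup m v) *
      (\<Prod>v\<in>range Z. c (var_index v) ^ Poly_Mapping.lookup m v)"
    unfolding UNIV_var by (subst prod.union_disjoint; (subst prod.union_disjoint)?; auto)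
  also have "\<dots> = (\<Prod>i\<in>UNIV. c i ^ mdeg m i)"
    by (simp add: prod.reindex inj mdeg_def power_add prod.distrib)
  finally show ?thesis
    by (simp add: monom_eval_eq_prod[of UNIV] power_mult_distrib prod.distrib)
qed

text \<open>Membership in the ideal means vanishing for all homogeneous coordinates of a point.
  Rescaling camera \<open>i\<close> by \<open>c i\<close> multiplies a monomial by a character of
  its multidegree, so the parts of different multidegree separate.\<close>

lemma multiview_ideal_homogeneous_part_vanishes:
  fixes A :: "'n::finite \<Rightarrow> 'k::alg_closed_field^4^3"
  assumes "p \<in> multiview_ideal A" and nz: "\<And>i. A i *v x \<noteq> 0"
  shows "(\<Sum>m | m \<in> Poly_Mapping.keys p \<and> mdeg m = d.
    Poly_Mapping.lookup p m * monom_eval (\<lambda>v. dot (camera_row A v) x) m) = 0"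
proof (rule multigraded_separation[OF infinite_alg_closed_field])
  show "finite (Poly_Mapping.keys p)" by simp
  fix c :: "'n \<Rightarrow> 'k" assume c: "\<forall>i. c i \<noteq> 0"
  have "x \<noteq> 0" using nz by auto
  define Q where "Q = proj_rel `` {x}"
  define P where "P = (\<lambda>i. proj_rel `` {A i *v x})"
  have "Q \<in> proj_space" unfolding Q_def proj_space_def
    using \<open>x \<noteq> 0\<close> by (intro quotientI) simp
  moreover have "x \<in> Q" unfolding Q_def proj_rel_def
    using \<open>x \<noteq> 0\<close> by (auto intro!: exI[of _ 1])
  ultimately have "P \<in> multiview_image A"
    unfolding multiview_image_def P_def using nz by blast
  then have "P \<in> multiview_variety A"
    unfolding multiview_variety_def zariski_closure_def by blast
  then have "vanishes_at p P"
    using assms(1) by (simp add: multiview_ideal_def)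
  moreover have "c i *s (A i *v x) \<in> P i" for i
    using nz[of i] c by (auto simp: P_def proj_rel_def)
  ultimately have "poly_eval (coords (\<lambda>i. c i *s (A i *v x))) p = 0"
    by (simp add: vanishes_at_def)
  moreover have "coords (\<lambda>i. c i *s (A i *v x)) =
      (\<lambda>v. c (var_index v) * dot (camera_row A v) x)"
  proof
    fix v show "coords (\<lambda>i. c i *s (A i *v x)) v = c (var_index v) * dot (camera_row A v) x"
      unfolding coords_camera[symmetric] by (cases v) simp_all
  qed
  ultimately show "(\<Sum>m\<in>Poly_Mapping.keys p.
      Poly_Mapping.lookup p m * monom_eval (\<lambda>v. dot (camera_row A v) x) m *
      (\<Prod>i\<in>UNIV. c i ^ mdeg m i)) = 0"
    by (simp add: poly_eval_eq_sum[of "Poly_Mapping.keys p"]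
        monom_eval_scaled_coords[of c "\<lambda>v. dot (camera_row A v) x"] mult_ac)
qed

section \<open>Curves with prescribed vanishing orders\<close>

lemma generic_solve:
  fixes A :: "'n::finite \<Rightarrow> 'k::field^4^3"
  assumes "generic_cameras A" "distinct [v1, v2, v3, v4]"
  obtains x where "dot (camera_row A v1) x = c1" "dot (camera_row A v2) x = c2"
    "dot (camera_row A v3) x = c3" "dot (camera_row A v4) x = c4"
proof -
  define M where "M = (\<chi> i::4. if i = 1 then camera_row A v1 else if i = 2 then camera_row A v2
    else if i = 3 then camera_row A v3 else camera_row A v4)"
  define y :: "'k^4" where "y = (\<chi> i. if i = 1 then c1 else if i = 2 then c2 else if i = 3 then c3 else c4)"
  have "det M \<noteq> 0"
    using det4_camera_rows_nonzero[OF assms] by (simp add: M_def det4_def)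
  then obtain B where "M ** B = mat 1"
    using invertible_det_nz invertible_def by metis
  then have "M *v (B *v y) = y"
    by (simp add: matrix_vector_mul_assoc)
  then have "\<forall>i. dot (M $ i) (B *v y) = y $ i"
    by (simp add: vec_eq_iff matrix_vector_mult_def dot_def)
  from this[unfolded forall_4] show ?thesis
    by (intro that[of "B *v y"]) (simp_all add: M_def y_def)
qed

lemma generic_unique:
  fixes A :: "'n::finite \<Rightarrow> 'k::field^4^3"
  assumes "generic_cameras A" "distinct [v1, v2, v3, v4]"
    "dot (camera_row A v1) x = 0" "dot (camera_row A v2) x = 0"
    "dot (camera_row A v3) x = 0" "dot (camera_row A v4) x = 0"
  shows "x = 0"
  using det4_camera_rows_nonzero[OF assms(1,2)] det4_eq_0_if_orthogonal[OF _ assms(3-6)] by blast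

lemma curve_with_prescribed_orders:
  fixes A :: "'n::{finite,linorder} \<Rightarrow> 'k::field^4^3"
  assumes "generic_cameras A" "CARD('n) \<ge> 2" "card {v. w v > 0} = 3"
  obtains x :: "'k \<Rightarrow> 'k^4" and h :: "'n var \<Rightarrow> 'k poly"
  where "\<And>v t. dot (camera_row A v) (x t) = t ^ w v * poly (h v) t" "\<And>v. poly (h v) 0 \<noteq> 0"
proof -
  obtain v1 v2 v3 where supp: "{v. w v > 0} = {v1, v2, v3}" and "distinct [v1, v2, v3]"
    using assms(3) by (auto simp: card_3_iff)
  \<comment> \<open>Two cameras already have four variables of the blocks \<open>X\<close> and
    \<open>Y\<close>.\<close>
  moreover have "\<exists>v4. v4 \<notin> {v1, v2, v3}"
  proof (rule ccontr)
    assume "\<nexists>v4. v4 \<notin> {v1, v2, v3}"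
    then have "range X \<union> range Y \<subseteq> {v1, v2, v3}" by blast
    then have "card (range X \<union> (range Y :: 'n var set)) \<le> card {v1, v2, v3}"
      by (intro card_mono) auto
    moreover have "card (range X \<union> (range Y :: 'n var set)) = 2 * CARD('n)"
      by (subst card_Un_disjoint) (auto simp: card_image inj_on_def)
    ultimately show False using assms(2) assms(3) supp by simp
  qed
  then obtain v4 where "v4 \<notin> {v1, v2, v3}" by blast
  ultimately have dist: "distinct [v1, v2, v3, v4]" by auto
  define r where "r = camera_row A"
  note solve = generic_solve[OF assms(1) dist, folded r_def]
  obtain e1 where e1: "dot (r v1) e1 = 1" "dot (r v2) e1 = 0" "dot (r v3) e1 = 0" "dot (r v4) e1 = 0"
    by (rule solve)
  obtain e2 where e2: "dot (r v1) e2 = 0" "dot (r v2) e2 = 1" "dot (r v3) e2 = 0" "dot (r v4) e2 = 0"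
    by (rule solve)
  obtain e3 where e3: "dot (r v1) e3 = 0" "dot (r v2) e3 = 0" "dot (r v3) e3 = 1" "dot (r v4) e3 = 0"
    by (rule solve)
  obtain e4 where e4: "dot (r v1) e4 = 0" "dot (r v2) e4 = 0" "dot (r v3) e4 = 0" "dot (r v4) e4 = 1"
    by (rule solve)
  \<comment> \<open>The vectors \<open>e1\<close> to \<open>e4\<close> are dual to the four chosen
    rows. At \<open>t = 0\<close> the curve passes through \<open>e4\<close>, which is orthogonal to
    exactly the three weighted rows.\<close>
  define x where "x t = e4 + (t ^ w v1 *s e1 + (t ^ w v2 *s e2 + t ^ w v3 *s e3))" for t
  define h where "h v = (if w v > 0 then 1 else [:dot (r v) e4:] + (monom (dot (r v) e1) (w v1) +
    (monom (dot (r v) e2) (w v2) + monom (dot (r v) e3) (w v3))))" for v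
  show ?thesis
  proof (rule that[of x h])
    fix v t
    show "dot (camera_row A v) (x t) = t ^ w v * poly (h v) t"
    proof (cases "w v > 0")
      case True
      then have "v \<in> {v1, v2, v3}" using supp by auto
      with True show ?thesis
        by (auto simp: x_def h_def dot_add_right dot_scale_right e1 e2 e3 e4 simp flip: r_def)
    next
      case False
      then show ?thesis
        by (simp add: x_def h_def dot_add_right dot_scale_right poly_monom mult_ac flip: r_def)
    qed
  next
    fix v
    show "poly (h v) 0 \<noteq> 0"
    proof (cases "w v > 0")
      case True
      then show ?thesis by (simp add: h_def)
    next
      case False
      have pos: "w v1 > 0" "w v2 > 0" "w v3 > 0" using supp by auto
      \<comment> \<open>Otherwise \<open>e4\<close> would be orthogonal to the rows of
        \<open>v1\<close>, \<open>v2\<close>, \<open>v3\<close> and \<open>v\<close>, four distinct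
        rows.\<close>
      have "dot (r v) e4 \<noteq> 0"
      proof
        assume "dot (r v) e4 = 0"
        moreover have "distinct [v1, v2, v3, v]" using dist pos False by auto
        ultimately have "e4 = 0"
          using generic_unique[OF assms(1)] e4 unfolding r_def by blast
        with e4(4) show False by (simp add: dot_def)
      qed
      with False pos show ?thesis by (simp add: h_def poly_monom power_0_left)
    qed
  qed
qed

section \<open>Orders of monomials along a curve\<close>

definition weight :: "('n var \<Rightarrow> nat) \<Rightarrow> 'n::finite monom \<Rightarrow> nat" where
  "weight w m = (\<Sum>v\<in>UNIV. w v * Poly_Mapping.lookup m v)"

text \<open>Along the curve above the monomial m has order weight w m, so a term of
  uniquely minimal weight cannot cancel.\<close>

lemma not_minimal_weight:
  fixes A :: "'n::{finite,linorder} \<Rightarrow> 'k::alg_closed_field^4^3"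
  assumes gen: "generic_cameras A" and card: "CARD('n) \<ge> 2" and w: "card {v. w v > 0} = 3"
    and p: "p \<in> multiview_ideal A" and m: "m \<in> Poly_Mapping.keys p"
    and min: "\<And>m'. m' \<in> Poly_Mapping.keys p \<Longrightarrow> mdeg m' = mdeg m \<Longrightarrow> m' \<noteq> m \<Longrightarrow> weight w m < weight w m'"
  shows False
proof -
  obtain x :: "'k \<Rightarrow> 'k^4" and h where x: "\<And>v t. dot (camera_row A v) (x t) = t ^ w v * poly (h v) t"
    and h: "\<And>v. poly (h v) 0 \<noteq> 0"
    using curve_with_prescribed_orders[OF gen card w] by metis
  define S where "S = {m' \<in> Poly_Mapping.keys p. mdeg m' = mdeg m}"
  have [simp]: "finite S" "m \<in> S" using m by (auto simp: S_def)
  define H where "H m' = (\<Prod>v\<in>UNIV. h v ^ Poly_Mapping.lookup m' v)" for m'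
  \<comment> \<open>The term of \<open>m'\<close> along the curve, as a polynomial in the parameter:
    a power of the parameter times a factor that is a product of the \<open>h v\<close>.\<close>
  define T where "T m' = smult (Poly_Mapping.lookup p m') (monom 1 (weight w m') * H m')" for m'
  have poly_T: "poly (T m') t = Poly_Mapping.lookup p m' * monom_eval (\<lambda>v. dot (camera_row A v) (x t)) m'"
    for m' t
    by (simp add: T_def H_def x monom_eval_eq_prod[of UNIV] poly_monom poly_prod power_mult_distrib
        prod.distrib weight_def power_sum power_mult)
  \<comment> \<open>Off this finite set all image coordinates are nonzero, so the curve point has an
    image in every camera.\<close>
  define B where "B = {t. \<exists>v. poly (h v) t = 0} \<union> {0}"
  have "h v \<noteq> 0" for v using h[of v] by auto
  then have "finite B" unfolding B_def by (simp add: poly_roots_finite Collect_ex_eq)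
  have "poly (sum T S) t = 0" if "t \<notin> B" for t
  proof -
    have "A i *v x t \<noteq> 0" for i
    proof
      assume "A i *v x t = 0"
      then have "coords (\<lambda>l. A l *v x t) (Z i) = 0" by simp
      then show False using that unfolding coords_camera x by (simp add: B_def)
    qed
    from multiview_ideal_homogeneous_part_vanishes[OF p this, of "mdeg m"] show ?thesis
      by (simp add: poly_sum poly_T S_def)
  qed
  then have "- B \<subseteq> {t. poly (sum T S) t = 0}" by auto
  moreover have "infinite (- B)"
    using \<open>finite B\<close> infinite_alg_closed_field by (simp add: Compl_eq_Diff_UNIV)
  ultimately have "sum T S = 0"
    by (intro poly_eq_0_if_infinite_roots) (rule infinite_super)
  then have "T m = - sum T (S - {m})"
    by (simp add: sum.remove[of S m] eq_neg_iff_add_eq_0)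
  moreover have "monom 1 (Suc (weight w m)) dvd sum T (S - {m})"
  proof (rule dvd_sum)
    fix m' assume "m' \<in> S - {m}"
    then have "Suc (weight w m) \<le> weight w m'" using min by (auto simp: S_def Suc_le_eq)
    then have "monom (1::'k) (Suc (weight w m)) dvd monom 1 (weight w m')"
      by (simp add: monom_1_dvd_iff)
    then show "monom 1 (Suc (weight w m)) dvd T m'"
      unfolding T_def by (intro dvd_smult dvd_mult2)
  qed
  ultimately have "monom 1 (Suc (weight w m)) dvd T m" by simp
  \<comment> \<open>Cancelling the power of the parameter leaves \<open>H m\<close>, whose value at
    0 is a product of nonzero numbers.\<close>
  then have "monom 1 (weight w m) * [:0, 1:] dvd monom 1 (weight w m) * smult (Poly_Mapping.lookup p m) (H m)"
    by (simp add: T_def monom_Suc mult.commute)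
  then have "[:0, 1:] dvd smult (Poly_Mapping.lookup p m) (H m)"
    by (subst (asm) dvd_mult_cancel_left) auto
  then have "poly (smult (Poly_Mapping.lookup p m) (H m)) 0 = 0"
    using poly_eq_0_iff_dvd[of "smult (Poly_Mapping.lookup p m) (H m)" 0] by simp
  then show False
    using m h by (simp add: H_def poly_prod in_keys_iff)
qed

section \<open>Weights that separate a standard monomial from smaller ones\<close>

text \<open>Comparison of numbers in base \<open>B\<close>. The bound concerns the \<open>b\<close>
  side alone, so one \<open>B\<close> computed from \<open>m\<close> serves for all competing
  \<open>m'\<close>.\<close>

lemma lex_less_weighted_sum:
  fixes a1 a2 a3 b1 b2 b3 B :: nat
  assumes B: "b1 + b2 + b3 < B"
    and lex: "b1 < a1 \<or> b1 \<le> a1 \<and> (b2 < a2 \<or> b2 \<le> a2 \<and> b3 < a3)"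
  shows "B\<^sup>2 * b1 + B * b2 + b3 < B\<^sup>2 * a1 + B * a2 + a3"
proof -
  have 3: "b3 < B" using B by simp
  have "B * b2 + b3 < B * (b2 + 1)" using 3 by simp
  also have "\<dots> \<le> B * B" using B by (intro mult_le_mono2) simp
  finally have 2: "B * b2 + b3 < B\<^sup>2" by (simp add: power2_eq_square)
  consider "b1 < a1" | "b1 \<le> a1" "b2 < a2" | "b1 \<le> a1" "b2 \<le> a2" "b3 < a3" using lex by blast
  then show ?thesis
  proof cases
    case 1
    then have "B\<^sup>2 * (b1 + 1) \<le> B\<^sup>2 * a1" by (intro mult_le_mono2) simp
    with 2 show ?thesis unfolding distrib_left mult_1_right by linarith
  next
    case 2
    then have "B\<^sup>2 * b1 \<le> B\<^sup>2 * a1" "B * (b2 + 1) \<le> B * a2" by (intro mult_le_mono2; simp)+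
    with 3 show ?thesis unfolding distrib_left mult_1_right by linarith
  next
    case less3: 3
    then have "B\<^sup>2 * b1 \<le> B\<^sup>2 * a1" "B * b2 \<le> B * a2" by (intro mult_le_mono2; simp)+
    with less3(3) show ?thesis by linarith
  qed
qed

definition M_monomials :: "'n monom set" where
  "M_monomials =
    {Poly_Mapping.single (X i) 1 + Poly_Mapping.single (X j) 1 | i j. i \<noteq> j} \<union>
    {Poly_Mapping.single (X i) 1 + (Poly_Mapping.single (Y j) 1 + Poly_Mapping.single (Y k) 1)
      | i j k. distinct [i, j, k]} \<union>
    {Poly_Mapping.single (Y i) 1 + (Poly_Mapping.single (Y j) 1 +
      (Poly_Mapping.single (Y k) 1 + Poly_Mapping.single (Y l) 1)) | i j k l. distinct [i, j, k, l]}"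

lemma M_monomialsI:
  "i \<noteq> j \<Longrightarrow> Poly_Mapping.single (X i) 1 + Poly_Mapping.single (X j) 1 \<in> M_monomials"
  "distinct [i, j, k] \<Longrightarrow> Poly_Mapping.single (X i) 1 +
    (Poly_Mapping.single (Y j) 1 + Poly_Mapping.single (Y k) 1) \<in> M_monomials"
  "distinct [i, j, k, l] \<Longrightarrow> Poly_Mapping.single (Y i) 1 + (Poly_Mapping.single (Y j) 1 +
    (Poly_Mapping.single (Y k) 1 + Poly_Mapping.single (Y l) 1)) \<in> M_monomials"
  unfolding M_monomials_def by blast+

definition monom_dvd :: "'n monom \<Rightarrow> 'n monom \<Rightarrow> bool" where
  "monom_dvd g m \<longleftrightarrow> (\<forall>v. Poly_Mapping.lookup g v \<le> Poly_Mapping.lookup m v)"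

lemma M_ideal_eq: "M_ideal = (ideal_gen (mon ` M_monomials) :: ('n, 'k::comm_ring_1) mpoly set)"
proof -
  have mon_mult: "mon m * mon m' = (mon (m + m') :: ('n, 'k) mpoly)" for m m'
    by (simp add: mon_def mult_single)
  show ?thesis
    unfolding M_ideal_def M_monomials_def image_Un var_def mon_mult add.assoc
    by (intro arg_cong[where f = ideal_gen] arg_cong2[where f = "(\<union>)"]) blast+
qed

lemma weight_eq_sum:
  assumes "{v. w v > 0} \<subseteq> F"
  shows "weight w m = (\<Sum>v\<in>F. w v * Poly_Mapping.lookup m v)"
  unfolding weight_def by (rule sum.mono_neutral_right) (use assms in auto)

text \<open>The exponent of \<open>Z l\<close> is determined by the multidegree and the exponents of
  \<open>X l\<close> and \<open>Y l\<close>. Hence the first difference is never at a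
  \<open>Z\<close>, and a loss at \<open>Y i\<close> is a gain at \<open>Z i\<close>.\<close>

lemma less_monom_same_mdeg:
  fixes m m' :: "'n::linorder monom"
  assumes "m' < m" "mdeg m' = mdeg m"
  obtains (X) i where "Poly_Mapping.lookup m' (X i) < Poly_Mapping.lookup m (X i)"
  | (Y) i where "Poly_Mapping.lookup m' (Y i) < Poly_Mapping.lookup m (Y i)"
    "\<And>l. Poly_Mapping.lookup m' (X l) = Poly_Mapping.lookup m (X l)"
    "\<And>l. l < i \<Longrightarrow> Poly_Mapping.lookup m' (Y l) = Poly_Mapping.lookup m (Y l)"
    "\<And>l. l < i \<Longrightarrow> Poly_Mapping.lookup m' (Z l) = Poly_Mapping.lookup m (Z l)"
    "Poly_Mapping.lookup m (Z i) < Poly_Mapping.lookup m' (Z i)"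
proof -
  from assms(1) obtain v where v: "Poly_Mapping.lookup m' v < Poly_Mapping.lookup m v"
    and before: "\<And>u. u < v \<Longrightarrow> Poly_Mapping.lookup m' u = Poly_Mapping.lookup m u"
    unfolding less_monom_iff by blast
  have deg: "Poly_Mapping.lookup m' (X l) + Poly_Mapping.lookup m' (Y l) + Poly_Mapping.lookup m' (Z l) =
      Poly_Mapping.lookup m (X l) + Poly_Mapping.lookup m (Y l) + Poly_Mapping.lookup m (Z l)" for l
    using fun_cong[OF assms(2), of l] by (simp add: mdeg_def)
  show ?thesis
  proof (cases v)
    case (X i)
    then show ?thesis using v that(1) by blast
  next
    case (Y i)
    have eq: "Poly_Mapping.lookup m' (X l) = Poly_Mapping.lookup m (X l)"
      "l < i \<Longrightarrow> Poly_Mapping.lookup m' (Y l) = Poly_Mapping.lookup m (Y l)" for l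
      by (rule before; simp add: Y less_var_def)+
    show ?thesis
    proof (rule that(2)[of i])
      show "Poly_Mapping.lookup m' (Z l) = Poly_Mapping.lookup m (Z l)" if "l < i" for l
        using deg[of l] eq(1)[of l] eq(2)[OF that] by simp
      show "Poly_Mapping.lookup m (Z i) < Poly_Mapping.lookup m' (Z i)"
        using deg[of i] eq(1)[of i] v Y by simp
    qed (use eq v Y in auto)
  next
    case (Z i)
    have "Poly_Mapping.lookup m' (X i) = Poly_Mapping.lookup m (X i)"
      "Poly_Mapping.lookup m' (Y i) = Poly_Mapping.lookup m (Y i)"
      by (rule before; simp add: Z less_var_def)+
    with deg[of i] v Z show ?thesis by simp
  qed
qed

text \<open>Y i and Z i have the same dominant weight, since a smaller exponent of X i only forces the sum of
  their exponents to grow; their difference and Z j then break ties in the order of i and j.\<close>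

lemma separating_weight_with_X:
  fixes m :: "'n::{finite,linorder} monom"
  assumes card: "CARD('n) \<ge> 2"
    and std: "\<And>g. g \<in> M_monomials \<Longrightarrow> \<not> monom_dvd g m"
    and Xi: "Poly_Mapping.lookup m (X i) > 0"
  obtains w where "card {v. w v > 0} = 3"
    "\<And>m'. m' < m \<Longrightarrow> mdeg m' = mdeg m \<Longrightarrow> weight w m < weight w m'"
proof -
  have X0: "Poly_Mapping.lookup m (X j) = 0" if "j \<noteq> i" for j
  proof (rule ccontr)
    assume "Poly_Mapping.lookup m (X j) \<noteq> 0"
    then have "monom_dvd (Poly_Mapping.single (X i) 1 + Poly_Mapping.single (X j) 1) m"
      using Xi that by (auto simp: monom_dvd_def lookup_add lookup_single when_def)
    then show False using std[OF M_monomialsI(1)[of i j]] that by blast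
  qed
  have Y0: "Poly_Mapping.lookup m (Y j) = 0 \<or> Poly_Mapping.lookup m (Y k) = 0"
    if "j \<noteq> i" "k \<noteq> i" "j \<noteq> k" for j k
  proof (rule ccontr)
    assume "\<not> ?thesis"
    then have "monom_dvd (Poly_Mapping.single (X i) 1 +
        (Poly_Mapping.single (Y j) 1 + Poly_Mapping.single (Y k) 1)) m"
      using Xi that by (auto simp: monom_dvd_def lookup_add lookup_single when_def)
    moreover have "distinct [i, j, k]" using that by auto
    ultimately show False using std[OF M_monomialsI(2)] by blast
  qed
  \<comment> \<open>At most one \<open>Y j\<close> with \<open>j \<noteq> i\<close> divides
    \<open>m\<close>; if there is none, any other camera will do.\<close>
  obtain j where "j \<noteq> i" and j: "\<And>k. k \<noteq> i \<Longrightarrow> k \<noteq> j \<Longrightarrow> Poly_Mapping.lookup m (Y k) = 0"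
  proof (cases "\<exists>j. j \<noteq> i \<and> Poly_Mapping.lookup m (Y j) \<noteq> 0")
    case True
    then show ?thesis using Y0 that by metis
  next
    case False
    have "UNIV \<noteq> {i}"
    proof
      assume "UNIV = {i}"
      then have "CARD('n) = card {i}" by (rule arg_cong)
      with card show False by simp
    qed
    then obtain j where "j \<noteq> i" by blast
    then show ?thesis using False that by blast
  qed
  \<comment> \<open>\<open>Z i\<close> is counted twice because it occurs in two of the three
    digits.\<close>
  define B where "B = Suc (Poly_Mapping.lookup m (Y i) + 2 * Poly_Mapping.lookup m (Z i) + Poly_Mapping.lookup m (Z j))"
  define w where "w v = (if v = Y i then B\<^sup>2 else if v = Z i then B\<^sup>2 + (if j < i then 1 else B)
    else if v = Z j then (if j < i then B else 1) else 0)" for v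
  have B: "Poly_Mapping.lookup m (Y i) + 2 * Poly_Mapping.lookup m (Z i) + Poly_Mapping.lookup m (Z j) < B"
    by (simp add: B_def)
  then have supp: "{v. w v > 0} = {Y i, Z i, Z j}"
    by (auto simp: w_def)
  have weight: "weight w m = (if j < i
      then B\<^sup>2 * (Poly_Mapping.lookup m (Y i) + Poly_Mapping.lookup m (Z i)) +
        B * Poly_Mapping.lookup m (Z j) + Poly_Mapping.lookup m (Z i)
      else B\<^sup>2 * (Poly_Mapping.lookup m (Y i) + Poly_Mapping.lookup m (Z i)) +
        B * Poly_Mapping.lookup m (Z i) + Poly_Mapping.lookup m (Z j))" for m
    unfolding weight_eq_sum[OF equalityD1[OF supp]] using \<open>j \<noteq> i\<close>
    by (simp add: w_def algebra_simps)
  show ?thesis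
  proof (rule that[of w])
    show "card {v. w v > 0} = 3" unfolding supp using \<open>j \<noteq> i\<close> by simp
    fix m' assume "m' < m" and deg: "mdeg m' = mdeg m"
    then show "weight w m < weight w m'"
    proof (cases rule: less_monom_same_mdeg)
      case (X k)
      \<comment> \<open>Only \<open>X i\<close> occurs in \<open>m\<close>; a loss there raises the
        leading digit.\<close>
      then have "k = i" using X0[of k] by (cases "k = i") auto
      then have "Poly_Mapping.lookup m (Y i) + Poly_Mapping.lookup m (Z i) <
          Poly_Mapping.lookup m' (Y i) + Poly_Mapping.lookup m' (Z i)"
        using X fun_cong[OF deg, of i] by (simp add: mdeg_def)
      then show ?thesis
        unfolding weight by (cases "j < i"; simp only: if_True if_False simp_thms)
          (rule lex_less_weighted_sum; use B in simp)+
    next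
      case (Y k)
      then have "k = i \<or> k = j" using j[of k] by force
      moreover have sum_eq: "Poly_Mapping.lookup m (Y i) + Poly_Mapping.lookup m (Z i) =
          Poly_Mapping.lookup m' (Y i) + Poly_Mapping.lookup m' (Z i)"
        using Y(2)[of i] fun_cong[OF deg, of i] by (simp add: mdeg_def)
      moreover have "i < j" if "\<not> j < i" using that \<open>j \<noteq> i\<close> by simp
      \<comment> \<open>The leading digits agree. If the first difference is at the later of
        \<open>i\<close> and \<open>j\<close>, the \<open>Z\<close> exponents of the earlier one
        agree too, so the first digit that changes grows.\<close>
      ultimately have "j < i \<and> (k = i \<and> Poly_Mapping.lookup m' (Z j) = Poly_Mapping.lookup m (Z j) \<or> k = j)
          \<or> \<not> j < i \<and> (k = i \<or> k = j \<and> Poly_Mapping.lookup m' (Z i) = Poly_Mapping.lookup m (Z i))"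
        using Y(4) by auto
      then show ?thesis
        unfolding weight using Y(5) sum_eq by (cases "j < i"; simp only: if_True if_False simp_thms)
          (rule lex_less_weighted_sum; use B in auto)+
    qed
  qed
qed

text \<open>A smaller monomial of the same multidegree first differs at some \<open>Y k\<close>
  dividing \<open>m\<close>, so it gains at \<open>Z k\<close>. Base \<open>B\<close> weights on
  three variables including all these \<open>Z k\<close> detect the gain; at most three are required
  because no quadrilinear generator divides \<open>m\<close>.\<close>

lemma separating_weight_without_X:
  fixes m :: "'n::{finite,linorder} monom"
  assumes card: "CARD('n) \<ge> 2"
    and std: "\<And>g. g \<in> M_monomials \<Longrightarrow> \<not> monom_dvd g m"
    and X0: "\<And>i. Poly_Mapping.lookup m (X i) = 0"
  obtains w where "card {v. w v > 0} = 3"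
    "\<And>m'. m' < m \<Longrightarrow> mdeg m' = mdeg m \<Longrightarrow> weight w m < weight w m'"
proof -
  define I where "I = {i. Poly_Mapping.lookup m (Y i) > 0}"
  have "card I \<le> 3"
  proof (rule ccontr)
    assume "\<not> card I \<le> 3"
    then have "4 \<le> card I" by simp
    then obtain T where "T \<subseteq> I" "card T = 4" by (rule obtain_subset_with_card_n)
    obtain ts where ts: "distinct ts" "set ts = T"
      using finite_distinct_list[of T] by auto
    then have "length ts = 4" using \<open>card T = 4\<close> distinct_card by fastforce
    then obtain i j k l where "ts = [i, j, k, l]"
      by (auto simp: numeral_eq_Suc length_Suc_conv)
    with ts have T: "T = {i, j, k, l}" and dist: "distinct [i, j, k, l]" by simp_all
    then have "monom_dvd (Poly_Mapping.single (Y i) 1 + (Poly_Mapping.single (Y j) 1 +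
      (Poly_Mapping.single (Y k) 1 + Poly_Mapping.single (Y l) 1))) m"
      using \<open>T \<subseteq> I\<close> by (auto simp: I_def monom_dvd_def lookup_add lookup_single when_def)
    then show False using std[OF M_monomialsI(3)[OF dist]] by blast
  qed
  then have "card (Z ` I) \<le> 3" by (simp add: card_image inj_on_def)
  moreover have "card (range X \<union> (range Z :: 'n var set)) = 2 * CARD('n)"
    by (subst card_Un_disjoint) (auto simp: card_image inj_on_def)
  then have "3 \<le> card (range X \<union> (range Z :: 'n var set))" using card by simp
  \<comment> \<open>The set is filled up with \<open>X\<close> and \<open>Z\<close> variables only:
    those before \<open>Z k\<close> have the same exponent in both monomials, while a
    \<open>Y\<close> variable could lose.\<close>
  ultimately obtain F where ZF: "Z ` I \<subseteq> F" and FXZ: "F \<subseteq> range X \<union> range Z" and F3: "card F = 3"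
    using exists_subset_between[of "Z ` I" 3 "range X \<union> range Z"] by auto
  obtain f1 f2 f3 where F: "F = {f1, f2, f3}" and f: "f1 < f2" "f2 < f3"
  proof -
    define xs where "xs = sorted_list_of_set F"
    have fin: "finite F" by simp
    have "length xs = 3" using F3 by (simp add: xs_def)
    then obtain a b c where xs: "xs = [a, b, c]"
      by (auto simp: numeral_3_eq_3 length_Suc_conv)
    have "sorted_wrt (<) xs" "set xs = F" by (simp_all add: xs_def)
    then show ?thesis
      using that[of a b c] xs by auto
  qed
  have f_neq: "f1 \<noteq> f2" "f1 \<noteq> f3" "f2 \<noteq> f3" using f by auto
  define B where "B = Suc (Poly_Mapping.lookup m f1 + Poly_Mapping.lookup m f2 + Poly_Mapping.lookup m f3)"
  define w where "w v = (if v = f1 then B\<^sup>2 else if v = f2 then B else if v = f3 then 1 else 0)" for v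
  have B: "Poly_Mapping.lookup m f1 + Poly_Mapping.lookup m f2 + Poly_Mapping.lookup m f3 < B"
    by (simp add: B_def)
  then have supp: "{v. w v > 0} = F"
    by (auto simp: w_def F)
  have weight: "weight w m = B\<^sup>2 * Poly_Mapping.lookup m f1 + B * Poly_Mapping.lookup m f2
      + Poly_Mapping.lookup m f3" for m
    unfolding weight_eq_sum[OF equalityD1[OF supp]] F using f_neq by (simp add: w_def)
  show ?thesis
  proof (rule that[of w])
    show "card {v. w v > 0} = 3" unfolding supp by (rule F3)
    fix m' assume "m' < m" and deg: "mdeg m' = mdeg m"
    then show "weight w m < weight w m'"
    proof (cases rule: less_monom_same_mdeg)
      case (X k)
      then show ?thesis using X0[of k] by simp
    next
      case (Y k)
      then have "Z k \<in> F" using ZF by (auto simp: I_def)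
      moreover have eq: "Poly_Mapping.lookup m' v = Poly_Mapping.lookup m v" if "v \<in> F" "v < Z k" for v
        using FXZ that Y(2,4) by (auto simp: less_var_def)
      ultimately show ?thesis
        unfolding weight using Y(5) f eq[of "f1"] eq[of "f2"] B
        by (intro lex_less_weighted_sum) (auto simp: F)
    qed
  qed
qed

section \<open>Equality of the two monomial ideals\<close>

text \<open>All other monomials of \<open>p\<close> are smaller than the initial one, so a
  separating weight would make it uniquely lightest in its multidegree, which
  \<open>not_minimal_weight\<close> excludes.\<close>

lemma initial_monomial_divisible:
  fixes A :: "'n::{finite,linorder} \<Rightarrow> 'k::alg_closed_field^4^3"
  assumes card: "CARD('n) \<ge> 2" and gen: "generic_cameras A"
    and p: "p \<in> multiview_ideal A" "p \<noteq> 0"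
  obtains g where "g \<in> M_monomials" "monom_dvd g (initial_monomial p)"
proof (rule ccontr)
  let ?m = "initial_monomial p"
  assume "\<not> thesis"
  then have std: "\<And>g. g \<in> M_monomials \<Longrightarrow> \<not> monom_dvd g ?m" using that by blast
  have ne: "Poly_Mapping.keys p \<noteq> {}" using p(2) by simp
  then have m: "?m \<in> Poly_Mapping.keys p" by (simp add: initial_monomial_def)
  have le: "m' \<le> ?m" if "m' \<in> Poly_Mapping.keys p" for m'
    using that by (simp add: initial_monomial_def)
  obtain w where w: "card {v. w v > 0} = 3"
    "\<And>m'. m' < ?m \<Longrightarrow> mdeg m' = mdeg ?m \<Longrightarrow> weight w ?m < weight w m'"
  proof (cases "\<exists>i. Poly_Mapping.lookup ?m (X i) > 0")
    case True
    then obtain i where "Poly_Mapping.lookup ?m (X i) > 0" by blast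
    from separating_weight_with_X[OF card std this] show ?thesis
      by (metis that)
  next
    case False
    then have "\<And>i. Poly_Mapping.lookup ?m (X i) = 0" by simp
    from separating_weight_without_X[OF card std this] show ?thesis
      by (metis that)
  qed
  have "weight w ?m < weight w m'" if "m' \<in> Poly_Mapping.keys p" "mdeg m' = mdeg ?m" "m' \<noteq> ?m" for m'
    using le[of m'] that by (intro w(2)) auto
  then show False
    by (rule not_minimal_weight[OF gen card w(1) p(1) m])
qed

lemma module_mult: "module ((*) :: 'a::comm_ring_1 \<Rightarrow> 'a \<Rightarrow> 'a)"
  by unfold_locales (simp_all add: algebra_simps)

lemma mon_in_ideal_gen:
  assumes "g \<in> G" "monom_dvd g m"
  shows "(mon m :: ('n, 'k::comm_ring_1) mpoly) \<in> ideal_gen (mon ` G)"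
proof -
  have "m = (m - g) + g"
    using assms(2) by (intro poly_mapping_eqI) (simp add: lookup_add lookup_minus monom_dvd_def)
  then have "(mon m :: ('n, 'k) mpoly) = mon (m - g) * mon g"
    by (simp add: mon_def mult_single)
  then show ?thesis
    using assms(1) by (simp add: module.span_scale[OF module_mult] module.span_base[OF module_mult])
qed

theorem lemma2p5:
  fixes A :: "'n::{finite,linorder} \<Rightarrow> 'k::alg_closed_field^4^3"
  assumes "CARD('n) \<ge> 2"
    and "\<And>i. rank (A i) = 3"
    and "generic_cameras A"
  shows "M_ideal = initial_ideal (multiview_ideal A)"
proof
  let ?I = "{mon (initial_monomial p) | p. p \<in> multiview_ideal A \<and> p \<noteq> 0} :: ('n, 'k) mpoly set"
  have "\<exists>p. p \<in> multiview_ideal A \<and> p \<noteq> 0 \<and> initial_monomial p = g" if "g \<in> M_monomials" for g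
  proof -
    from that show ?thesis
      unfolding M_monomials_def
    proof (elim UnE CollectE exE conjE)
      fix i j :: 'n
      assume "i \<noteq> j" and g: "g = Poly_Mapping.single (X i) 1 + Poly_Mapping.single (X j) 1"
      from initial_monomial_bilinear[OF assms(3) this(1)] show ?thesis unfolding g by blast
    next
      fix i j k :: 'n
      assume g: "g = Poly_Mapping.single (X i) 1 + (Poly_Mapping.single (Y j) 1 + Poly_Mapping.single (Y k) 1)"
        and "distinct [i, j, k]"
      from initial_monomial_trilinear[OF assms(3) this(2)] show ?thesis unfolding g by blast
    next
      fix i j k l :: 'n
      assume g: "g = Poly_Mapping.single (Y i) 1 + (Poly_Mapping.single (Y j) 1 +
          (Poly_Mapping.single (Y k) 1 + Poly_Mapping.single (Y l) 1))"
        and "distinct [i, j, k, l]"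
      from initial_monomial_quadrilinear[OF assms(3) this(2)] show ?thesis unfolding g by blast
    qed
  qed
  then have "mon ` M_monomials \<subseteq> ?I" by (intro image_subsetI CollectI) metis
  then show "M_ideal \<subseteq> initial_ideal (multiview_ideal A)"
    unfolding M_ideal_eq initial_ideal_def by (rule module.span_mono[OF module_mult])
  have "?I \<subseteq> M_ideal"
  proof
    fix q assume "q \<in> ?I"
    then obtain p where p: "p \<in> multiview_ideal A" "p \<noteq> 0" and q: "q = mon (initial_monomial p)"
      by blast
    obtain g where "g \<in> M_monomials" "monom_dvd g (initial_monomial p)"
      by (rule initial_monomial_divisible[OF assms(1,3) p])
    then show "q \<in> M_ideal"
      unfolding M_ideal_eq q by (rule mon_in_ideal_gen)
  qed
  then show "initial_ideal (multiview_ideal A) \<subseteq> M_ideal"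
    unfolding M_ideal_eq initial_ideal_def
    by (intro module.span_minimal[OF module_mult] module.subspace_span[OF module_mult])
qed

end
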